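(* Let $(\mathcal{S},\partial,\int)$ be a commutative integro-differential ring with ring of constants $\mathcal{C}$. Let $f,g,h\in T(\mathcal{S})$ be pure tensors of length $n$, $m$, and $l$, respectively. Then $$e(f\sqcup\!\sqcup g,h)-e(f,g\sqcup\!\sqcup h)+\sum_{j=0}^{m-1}\Bigg(\sum_{i=0}^{n-1}e\big(f_{i+1}^n,g_{j+1}^m\big)\,e\big(f_1^i\sqcup\!\sqcup g_1^j,h\big)-\sum_{k=0}^{l-1}e\big(f,g_1^j\sqcup\!\sqcup h_1^k\big)\,e\big(g_{j+1}^m,h_{k+1}^l\big)\Bigg)=0.$$
   Context: Rings have a unit. A differential ring $(\mathcal{S},\partial)$ is a ring with an additive map $\partial$ satisfying $\partial(fg)=(\partial f)g+f\,\partial g$; its ring of constants is $\mathcal{C}=\ker\partial$. An integro-differential ring $(\mathcal{S},\partial,\int)$ is a differential ring with a $\mathcal{C}$-linear map $\int:\mathcal{S}\to\mathcal{S}$ such that $\partial\int=\mathrm{id}$. Its evaluation is $\mathrm{E}:=\mathrm{id}-\int\partial:\mathcal{S}\to\mathcal{C}$ (not assumed multiplicative). $T(\mathcal{S})=\bigoplus_{n\ge0}\mathcal{S}^{\otimes n}$ is the tensor module over $\mathcal{C}$, with empty tensor $1_{T(\mathcal{S})}$. The shuffle product $\sqcup\!\sqcup$ on it is the biadditive ($\mathcal{C}$-bilinear) product given on pure tensors $t=t_1\otimes\dots\otimes t_n$, $s=s_1\otimes\dots\otimes s_m$ by $t\sqcup\!\sqcup s=t\otimes s$ if $n=0$ or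 $m=0$, and by $t\sqcup\!\sqcup s=t_1\otimes((t_2\otimes\dots\otimes t_n)\sqcup\!\sqcup s)+s_1\otimes(t\sqcup\!\sqcup(s_2\otimes\dots\otimes s_m))$ if $n,m\ge1$. For a pure tensor $f=f_1\otimes\dots\otimes f_n$ put $f_i^j:=f_i\otimes\dots\otimes f_j$ for $1\le i\le n+1$, $0\le j\le n$, $i\le j+1$, where $f_i^j=1_{T(\mathcal{S})}$ if $i=j+1$. The $\mathcal{C}$-linear map $\sigma:T(\mathcal{S})\to\mathcal{S}$ is defined on pure tensors by the nested integral $\sigma(f_1\otimes\dots\otimes f_n)=\int\big(f_1\int\big(f_2\cdots\int f_n\big)\cdots\big)$, with $\sigma(1_{T(\mathcal{S})})=1$. The $\mathcal{C}$-bilinear map $e:T(\mathcal{S})\times T(\mathcal{S})\to\mathcal{C}$ is $e(f,g):=\mathrm{E}(\sigma(f)\sigma(g))$. *)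

theory Defs
  imports "HOL-Library.Poly_Mapping"
begin

(* Built on comm_ring + comm_monoid_mult rather than comm_ring_1 because the latter
   excludes the zero ring. *)
class comm_differential_ring = comm_ring + comm_monoid_mult +
  fixes der :: "'a \<Rightarrow> 'a"
  assumes der_add: "der (f + g) = der f + der g"
    and der_mult: "der (f * g) = der f * g + f * der g"

definition constants :: "'a::comm_differential_ring set"
  where "constants = {c. der c = 0}"

class comm_integro_differential_ring = comm_differential_ring +
  fixes integ :: "'a \<Rightarrow> 'a"
  assumes integ_add: "integ (f + g) = integ f + integ g"
    and integ_scale: "der c = 0 \<Longrightarrow> integ (c * f) = c * integ f"
    and der_integ: "der (integ f) = f"

definition evaluation :: "'a::comm_integro_differential_ring \<Rightarrow> 'a"
  where "evaluation f = f - integ (der f)"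

lemma der_zero [simp]: "der (0::'a::comm_differential_ring) = 0"
  using der_add[of "0::'a" 0] by simp

lemma der_uminus: "der (- f) = - der (f::'a::comm_differential_ring)"
proof -
  have "der (- f) + der f = 0" by (simp flip: der_add)
  thus ?thesis by (simp add: eq_neg_iff_add_eq_0)
qed

lemma der_diff: "der (f - g) = der f - der (g::'a::comm_differential_ring)"
  using der_add[of f "- g"] by (simp add: der_uminus)

lemma der_one [simp]: "der (1::'a::comm_differential_ring) = 0"
  using der_mult[of "1::'a" 1] by simp

lemma constants_closed:
  fixes a b :: "'a::comm_differential_ring"
  shows "0 \<in> (constants :: 'a set)" "1 \<in> (constants :: 'a set)"
    "a \<in> constants \<Longrightarrow> - a \<in> constants"
    "a \<in> constants \<Longrightarrow> b \<in> constants \<Longrightarrow> a + b \<in> constants"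
    "a \<in> constants \<Longrightarrow> b \<in> constants \<Longrightarrow> a * b \<in> constants"
  by (auto simp: constants_def der_uminus der_add der_mult)

lemma evaluation_constant: "evaluation f \<in> constants"
  by (simp add: evaluation_def constants_def der_diff der_integ)


(* T(S) is the free C-module on words over S modulo multilinearity over C. A word
   f1...fn stands for the pure tensor of f1,...,fn, the empty word for 1 in C. Since C is not
   a type, elements of the free module are finitely supported functions from words to S with
   values in C. *)

definition smul :: "'a \<Rightarrow> ('b \<Rightarrow>\<^sub>0 'a) \<Rightarrow> ('b \<Rightarrow>\<^sub>0 'a::comm_differential_ring)"
  where "smul c p = Poly_Mapping.map ((*) c) p"

definition const_coeffs :: "('b \<Rightarrow>\<^sub>0 'a::comm_differential_ring) \<Rightarrow> bool"
  where "const_coeffs p \<longleftrightarrow> (\<forall>w. Poly_Mapping.lookup p w \<in> constants)"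

inductive_set multilinear_relations :: "('a list \<Rightarrow>\<^sub>0 'a::comm_differential_ring) set" where
  rel_zero: "0 \<in> multilinear_relations"
| rel_add: "p \<in> multilinear_relations \<Longrightarrow> q \<in> multilinear_relations \<Longrightarrow>
    p + q \<in> multilinear_relations"
| rel_smul: "c \<in> constants \<Longrightarrow> p \<in> multilinear_relations \<Longrightarrow>
    smul c p \<in> multilinear_relations"
| rel_additive: "Poly_Mapping.single (xs @ (a + b) # ys) 1
    - Poly_Mapping.single (xs @ a # ys) 1
    - Poly_Mapping.single (xs @ b # ys) 1 \<in> multilinear_relations"
| rel_homogeneous: "c \<in> constants \<Longrightarrow>
    Poly_Mapping.single (xs @ (c * a) # ys) 1
    - Poly_Mapping.single (xs @ a # ys) c \<in> multilinear_relations"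

definition tensor_eq ::
  "('a list \<Rightarrow>\<^sub>0 'a) \<Rightarrow> ('a list \<Rightarrow>\<^sub>0 'a::comm_differential_ring) \<Rightarrow> bool"
  where "tensor_eq p q \<longleftrightarrow>
    const_coeffs p \<and> const_coeffs q \<and> p - q \<in> multilinear_relations"

lemma lookup_smul [simp]:
  "Poly_Mapping.lookup (smul c p) w = c * Poly_Mapping.lookup p w"
  by (simp add: smul_def Poly_Mapping.map.rep_eq when_def)

lemma smul_simps:
  "smul c (p + q) = smul c p + smul c q" "smul c (p - q) = smul c p - smul c q"
  "smul (c + d) p = smul c p + smul d p" "smul c (smul d p) = smul (c * d) p"
  "smul 1 p = p" "smul 0 p = 0" "smul c 0 = 0" "smul (- 1) p = - p"
  by (rule poly_mapping_eqI;
      simp add: lookup_add lookup_minus algebra_simps minus_mult_left[symmetric])+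

lemma smul_single: "smul c (Poly_Mapping.single w d) = Poly_Mapping.single w (c * d)"
  by (rule poly_mapping_eqI) (simp add: lookup_single when_def)

lemma smul_sum: "smul c (\<Sum>x\<in>A. f x) = (\<Sum>x\<in>A. smul c (f x))"
  by (induction A rule: infinite_finite_induct) (simp_all add: smul_simps)

lemma rel_uminus: "p \<in> multilinear_relations \<Longrightarrow> - p \<in> multilinear_relations"
  using rel_smul[of "- 1" p] by (simp add: smul_simps constants_closed)

lemma rel_sum:
  "(\<And>x. x \<in> A \<Longrightarrow> f x \<in> multilinear_relations) \<Longrightarrow> (\<Sum>x\<in>A. f x) \<in> multilinear_relations"
  by (induction A rule: infinite_finite_induct) (auto intro: rel_zero rel_add)

lemma const_coeffs_closed:
  "const_coeffs 0"
  "const_coeffs p \<Longrightarrow> const_coeffs q \<Longrightarrow> const_coeffs (p + q)"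
  "const_coeffs p \<Longrightarrow> const_coeffs (- p)"
  "c \<in> constants \<Longrightarrow> const_coeffs p \<Longrightarrow> const_coeffs (smul c p)"
  "c \<in> constants \<Longrightarrow> const_coeffs (Poly_Mapping.single w c)"
  by (auto simp: const_coeffs_def lookup_add lookup_uminus lookup_single when_def constants_closed)

lemma const_coeffs_sum:
  "(\<And>x. x \<in> A \<Longrightarrow> const_coeffs (f x)) \<Longrightarrow> const_coeffs (\<Sum>x\<in>A. f x)"
  by (induction A rule: infinite_finite_induct) (auto intro: const_coeffs_closed)

lemma tensor_eq_sym: "tensor_eq p q \<Longrightarrow> tensor_eq q p"
  using rel_uminus[of "p - q"] by (auto simp: tensor_eq_def)

lemma tensor_eq_trans: "tensor_eq p q \<Longrightarrow> tensor_eq q r \<Longrightarrow> tensor_eq p r"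
  using rel_add[of "p - q" "q - r"] by (auto simp: tensor_eq_def)

lemma tensor_eq_refl: "const_coeffs p \<Longrightarrow> tensor_eq p p"
  by (auto simp: tensor_eq_def rel_zero)

quotient_type (overloaded) 'a tensor = "'a::comm_differential_ring list \<Rightarrow>\<^sub>0 'a" / partial: tensor_eq
  by (rule part_equivpI)
     (auto intro: tensor_eq_sym tensor_eq_trans tensor_eq_refl const_coeffs_closed
       exI[of _ 0] sympI transpI)

instantiation tensor :: (comm_differential_ring) ab_group_add
begin

lift_definition zero_tensor :: "'a tensor" is 0
  by (intro tensor_eq_refl const_coeffs_closed)

lift_definition plus_tensor :: "'a tensor \<Rightarrow> 'a tensor \<Rightarrow> 'a tensor" is "(+)"
proof -
  fix p q r s :: "'a list \<Rightarrow>\<^sub>0 'a"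
  assume "tensor_eq p q" "tensor_eq r s"
  thus "tensor_eq (p + r) (q + s)"
    using rel_add[of "p - q" "r - s"]
    by (auto simp: tensor_eq_def const_coeffs_closed algebra_simps)
qed

lift_definition uminus_tensor :: "'a tensor \<Rightarrow> 'a tensor" is uminus
proof -
  fix p q :: "'a list \<Rightarrow>\<^sub>0 'a"
  assume "tensor_eq p q"
  thus "tensor_eq (- p) (- q)"
    using rel_uminus[of "p - q"] by (auto simp: tensor_eq_def const_coeffs_closed)
qed

definition minus_tensor :: "'a tensor \<Rightarrow> 'a tensor \<Rightarrow> 'a tensor"
  where "minus_tensor s t = s + - t"

instance
proof
  fix a b c :: "'a tensor"
  show "a + b + c = a + (b + c)"
    by transfer (auto simp: add.assoc intro!: tensor_eq_refl const_coeffs_closed simp: tensor_eq_def)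
  show "a + b = b + a"
    by transfer (auto simp: add.commute intro!: tensor_eq_refl const_coeffs_closed simp: tensor_eq_def)
  show "0 + a = a" by transfer simp
  show "- a + a = 0"
    by transfer (auto intro!: tensor_eq_refl const_coeffs_closed)
  show "a - b = a + - b" by (simp add: minus_tensor_def)
qed

end

lift_definition pure_tensor :: "'a::comm_differential_ring list \<Rightarrow> 'a tensor"
  is "\<lambda>w. Poly_Mapping.single w 1"
  by (intro tensor_eq_refl const_coeffs_closed constants_closed)


(* C-linear extension of a map given on words *)
definition lin_ext ::
  "('b \<Rightarrow> ('c \<Rightarrow>\<^sub>0 'a)) \<Rightarrow> ('b \<Rightarrow>\<^sub>0 'a) \<Rightarrow> ('c \<Rightarrow>\<^sub>0 'a::comm_differential_ring)"
  where "lin_ext F p =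
    (\<Sum>w\<in>Poly_Mapping.keys p. smul (Poly_Mapping.lookup p w) (F w))"

definition cons_raw :: "'a \<Rightarrow> ('a list \<Rightarrow>\<^sub>0 'a) \<Rightarrow> ('a list \<Rightarrow>\<^sub>0 'a::comm_differential_ring)"
  where "cons_raw a = lin_ext (\<lambda>w. Poly_Mapping.single (a # w) 1)"

fun shuffle_words :: "'a list \<Rightarrow> 'a list \<Rightarrow> ('a list \<Rightarrow>\<^sub>0 'a::comm_differential_ring)" where
  "shuffle_words [] v = Poly_Mapping.single v 1"
| "shuffle_words u [] = Poly_Mapping.single u 1"
| "shuffle_words (a # u) (b # v) =
     cons_raw a (shuffle_words u (b # v)) + cons_raw b (shuffle_words (a # u) v)"

definition shuffle_raw ::
  "('a list \<Rightarrow>\<^sub>0 'a) \<Rightarrow> ('a list \<Rightarrow>\<^sub>0 'a) \<Rightarrow> ('a list \<Rightarrow>\<^sub>0 'a::comm_differential_ring)"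
  where "shuffle_raw p q = lin_ext (\<lambda>u. lin_ext (shuffle_words u) q) p"

lemma lin_ext_superset:
  "finite A \<Longrightarrow> Poly_Mapping.keys p \<subseteq> A \<Longrightarrow>
   lin_ext F p = (\<Sum>w\<in>A. smul (Poly_Mapping.lookup p w) (F w))"
  unfolding lin_ext_def
  by (rule sum.mono_neutral_left) (auto simp: in_keys_iff smul_simps)

lemma lin_ext_add: "lin_ext F (p + q) = lin_ext F p + lin_ext F q"
proof -
  let ?A = "Poly_Mapping.keys p \<union> Poly_Mapping.keys q"
  have "Poly_Mapping.keys (p + q) \<subseteq> ?A" by (rule Poly_Mapping.keys_add)
  thus ?thesis
    by (simp add: lin_ext_superset[of ?A] lookup_add smul_simps sum.distrib)
qed

lemma lin_ext_smul: "lin_ext F (smul c p) = smul c (lin_ext F p)"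
proof -
  have "Poly_Mapping.keys (smul c p) \<subseteq> Poly_Mapping.keys p"
    by (auto simp: in_keys_iff)
  thus ?thesis
    by (simp add: lin_ext_superset[of "Poly_Mapping.keys p"] smul_sum smul_simps)
qed

lemma lin_ext_zero: "lin_ext F 0 = 0"
  by (simp add: lin_ext_def)

lemma lin_ext_diff: "lin_ext F (p - q) = lin_ext F p - lin_ext F q"
  using lin_ext_add[of F "p - q" q] by simp

lemma lin_ext_single: "lin_ext F (Poly_Mapping.single w c) = smul c (F w)"
  using lin_ext_superset[of "{w}" "Poly_Mapping.single w c" F] by (simp split: if_splits)

lemma lin_ext_rel:
  "(\<And>w. F w \<in> multilinear_relations) \<Longrightarrow> const_coeffs p \<Longrightarrow>
   lin_ext F p \<in> multilinear_relations"
  unfolding lin_ext_def const_coeffs_def by (intro rel_sum rel_smul) auto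

lemma lin_ext_const:
  "(\<And>w. const_coeffs (F w)) \<Longrightarrow> const_coeffs p \<Longrightarrow> const_coeffs (lin_ext F p)"
  unfolding lin_ext_def by (intro const_coeffs_sum const_coeffs_closed) (auto simp: const_coeffs_def)

lemma lin_ext_fun_diff: "lin_ext (\<lambda>w. F w - G w) p = lin_ext F p - lin_ext G p"
  by (simp add: lin_ext_def smul_simps sum_subtractf)

lemma lin_ext_fun_smul: "lin_ext (\<lambda>w. smul c (F w)) p = smul c (lin_ext F p)"
  by (simp add: lin_ext_def smul_simps smul_sum mult.commute)

lemma lin_ext_preserves_rel:
  assumes "p \<in> multilinear_relations"
    and "\<And>xs a b ys. F (xs @ (a + b) # ys) - F (xs @ a # ys) - F (xs @ b # ys)
           \<in> multilinear_relations"
    and "\<And>c xs a ys. c \<in> constants \<Longrightarrow>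
           F (xs @ (c * a) # ys) - smul c (F (xs @ a # ys)) \<in> multilinear_relations"
  shows "lin_ext F p \<in> multilinear_relations"
  using assms(1)
  by induction
     (auto simp: lin_ext_zero lin_ext_add lin_ext_smul lin_ext_diff lin_ext_single smul_simps
       intro: rel_zero rel_add rel_smul assms(2,3))

lemma cons_raw_rel: "p \<in> multilinear_relations \<Longrightarrow> cons_raw a p \<in> multilinear_relations"
  unfolding cons_raw_def
proof (erule lin_ext_preserves_rel)
  fix xs :: "'a list" and x b ys
  show "Poly_Mapping.single (a # xs @ (x + b) # ys) 1 - Poly_Mapping.single (a # xs @ x # ys) 1 -
    Poly_Mapping.single (a # xs @ b # ys) 1 \<in> multilinear_relations"
    using rel_additive[of "a # xs"] by simp
next
  fix c :: 'a and xs x ys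
  assume "c \<in> constants"
  thus "Poly_Mapping.single (a # xs @ (c * x) # ys) 1
    - smul c (Poly_Mapping.single (a # xs @ x # ys) 1) \<in> multilinear_relations"
    using rel_homogeneous[of c "a # xs"] by (simp add: smul_single)
qed

lemma cons_raw_diff: "cons_raw a (p - q) = cons_raw a p - cons_raw a q"
  by (simp add: cons_raw_def lin_ext_diff)

lemma cons_raw_add: "cons_raw a (p + q) = cons_raw a p + cons_raw a q"
  by (simp add: cons_raw_def lin_ext_add)

lemma cons_raw_smul: "cons_raw a (smul c p) = smul c (cons_raw a p)"
  by (simp add: cons_raw_def lin_ext_smul)

lemma cons_raw_additive:
  assumes "const_coeffs p"
  shows "cons_raw (a + b) p - cons_raw a p - cons_raw b p \<in> multilinear_relations"
  unfolding cons_raw_def lin_ext_fun_diff[symmetric]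
  using rel_additive[of "[]"] by (intro lin_ext_rel assms) simp

lemma cons_raw_homogeneous:
  assumes "const_coeffs p" "c \<in> constants"
  shows "cons_raw (c * a) p - smul c (cons_raw a p) \<in> multilinear_relations"
  unfolding cons_raw_def lin_ext_fun_diff[symmetric] lin_ext_fun_smul[symmetric]
  using rel_homogeneous[OF assms(2), of "[]"] 
  by (intro lin_ext_rel assms) (simp add: smul_single)

lemma cons_raw_const: "const_coeffs p \<Longrightarrow> const_coeffs (cons_raw a p)"
  unfolding cons_raw_def by (intro lin_ext_const const_coeffs_closed constants_closed)

lemma shuffle_words_const: "const_coeffs (shuffle_words u v)"
  by (induction u v rule: shuffle_words.induct)
     (auto intro!: const_coeffs_closed constants_closed cons_raw_const)

lemma shuffle_words_Nil2 [simp]: "shuffle_words u [] = Poly_Mapping.single u 1"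
  by (cases u) auto

lemma shuffle_words_commute: "shuffle_words u v = shuffle_words v u"
  by (induction u v rule: shuffle_words.induct) (simp_all add: add.commute)

lemma shuffle_words_additive:
  "shuffle_words u (xs @ (a + b) # ys) - shuffle_words u (xs @ a # ys)
     - shuffle_words u (xs @ b # ys) \<in> multilinear_relations"
proof (induction "length u + length xs" arbitrary: u xs rule: less_induct)
  case less
  show ?case
  proof (cases u)
    case Nil
    thus ?thesis by (simp add: rel_additive)
  next
    case (Cons z u')
    note u = this
    have 1: "cons_raw z (shuffle_words u' (xs @ (a + b) # ys) - shuffle_words u' (xs @ a # ys)
     - shuffle_words u' (xs @ b # ys)) \<in> multilinear_relations"
      using u by (intro cons_raw_rel less) simp
    show ?thesis
    proof (cases xs)
      case Nil
      have "cons_raw (a + b) (shuffle_words u ys) - cons_raw a (shuffle_words u ys)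
        - cons_raw b (shuffle_words u ys) \<in> multilinear_relations"
        by (intro cons_raw_additive shuffle_words_const)
      from rel_add[OF 1 this] show ?thesis
        using u Nil by (simp add: cons_raw_diff cons_raw_add algebra_simps)
    next
      case (Cons x xs')
      have "cons_raw x (shuffle_words u (xs' @ (a + b) # ys) - shuffle_words u (xs' @ a # ys)
        - shuffle_words u (xs' @ b # ys)) \<in> multilinear_relations"
        using Cons by (intro cons_raw_rel less) simp
      from rel_add[OF 1 this] show ?thesis
        using u Cons by (simp add: cons_raw_diff cons_raw_add algebra_simps)
    qed
  qed
qed

lemma shuffle_words_homogeneous:
  assumes c: "c \<in> constants"
  shows "shuffle_words u (xs @ (c * a) # ys) - smul c (shuffle_words u (xs @ a # ys))
    \<in> multilinear_relations"
proof (induction "length u + length xs" arbitrary: u xs rule: less_induct)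
  case less
  show ?case
  proof (cases u)
    case Nil
    thus ?thesis by (simp add: rel_homogeneous c smul_single)
  next
    case (Cons z u')
    note u = this
    have 1: "cons_raw z (shuffle_words u' (xs @ (c * a) # ys)
       - smul c (shuffle_words u' (xs @ a # ys))) \<in> multilinear_relations"
      using u by (intro cons_raw_rel less) simp
    show ?thesis
    proof (cases xs)
      case Nil
      have "cons_raw (c * a) (shuffle_words u ys) - smul c (cons_raw a (shuffle_words u ys))
         \<in> multilinear_relations"
        by (intro cons_raw_homogeneous shuffle_words_const c)
      from rel_add[OF 1 this] show ?thesis
        using u Nil by (simp add: cons_raw_diff cons_raw_add cons_raw_smul smul_simps algebra_simps)
    next
      case (Cons x xs')
      have "cons_raw x (shuffle_words u (xs' @ (c * a) # ys)
         - smul c (shuffle_words u (xs' @ a # ys))) \<in> multilinear_relations"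
        using Cons by (intro cons_raw_rel less) simp
      from rel_add[OF 1 this] show ?thesis
        using u Cons by (simp add: cons_raw_diff cons_raw_add cons_raw_smul smul_simps algebra_simps)
    qed
  qed
qed

lemma shuffle_raw_commute: "shuffle_raw p q = shuffle_raw q p"
proof -
  have *: "shuffle_raw p q = (\<Sum>u\<in>Poly_Mapping.keys p. \<Sum>v\<in>Poly_Mapping.keys q.
      smul (Poly_Mapping.lookup p u * Poly_Mapping.lookup q v) (shuffle_words u v))"
    for p q :: "'a list \<Rightarrow>\<^sub>0 'a"
    by (simp add: shuffle_raw_def lin_ext_def smul_sum smul_simps)
  have "shuffle_raw p q = (\<Sum>v\<in>Poly_Mapping.keys q. \<Sum>u\<in>Poly_Mapping.keys p.
      smul (Poly_Mapping.lookup p u * Poly_Mapping.lookup q v) (shuffle_words u v))"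
    unfolding * by (rule sum.swap)
  also have "\<dots> = shuffle_raw q p"
    unfolding *
    by (intro sum.cong refl arg_cong2[where f = smul] mult.commute shuffle_words_commute)
  finally show ?thesis .
qed

lemma shuffle_raw_const: "const_coeffs p \<Longrightarrow> const_coeffs q \<Longrightarrow> const_coeffs (shuffle_raw p q)"
  unfolding shuffle_raw_def by (intro lin_ext_const shuffle_words_const)

lemma shuffle_raw_rel:
  assumes "const_coeffs p" "q \<in> multilinear_relations"
  shows "shuffle_raw p q \<in> multilinear_relations"
  unfolding shuffle_raw_def
  by (intro lin_ext_rel assms(1) lin_ext_preserves_rel[OF assms(2)]
      shuffle_words_additive shuffle_words_homogeneous)

lemma shuffle_raw_diff_right: "shuffle_raw p (q - r) = shuffle_raw p q - shuffle_raw p r"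
  by (simp add: shuffle_raw_def lin_ext_diff lin_ext_fun_diff)

lemma shuffle_raw_add_left: "shuffle_raw (p + q) r = shuffle_raw p r + shuffle_raw q r"
  by (simp add: shuffle_raw_def lin_ext_add)

lift_definition shuffle ::
  "'a::comm_differential_ring tensor \<Rightarrow> 'a tensor \<Rightarrow> 'a tensor" (infixl "\<squnion>\<squnion>" 70)
  is shuffle_raw
proof -
  fix p p' q q' :: "'a list \<Rightarrow>\<^sub>0 'a"
  assume p: "tensor_eq p p'" and q: "tensor_eq q q'"
  have *: "tensor_eq (shuffle_raw r s) (shuffle_raw r s')"
    if "const_coeffs r" "tensor_eq s s'" for r s s' :: "'a list \<Rightarrow>\<^sub>0 'a"
    using that shuffle_raw_rel[of r "s - s'"]
    by (auto simp: tensor_eq_def shuffle_raw_const shuffle_raw_diff_right)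
  have "tensor_eq (shuffle_raw p q) (shuffle_raw p q')"
    using p q by (intro *) (auto simp: tensor_eq_def)
  moreover have "tensor_eq (shuffle_raw q' p) (shuffle_raw q' p')"
    using p q by (intro *) (auto simp: tensor_eq_def)
  ultimately show "tensor_eq (shuffle_raw p q) (shuffle_raw p' q')"
    by (metis shuffle_raw_commute tensor_eq_trans)
qed


fun nested_integral :: "'a::comm_integro_differential_ring list \<Rightarrow> 'a" where
  "nested_integral [] = 1"
| "nested_integral (f # fs) = integ (f * nested_integral fs)"

definition sigma_raw :: "('a list \<Rightarrow>\<^sub>0 'a) \<Rightarrow> 'a::comm_integro_differential_ring"
  where "sigma_raw p = 
    (\<Sum>w\<in>Poly_Mapping.keys p. Poly_Mapping.lookup p w * nested_integral w)"

lemma sigma_raw_superset: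
  "finite A \<Longrightarrow> Poly_Mapping.keys p \<subseteq> A \<Longrightarrow>
   sigma_raw p = (\<Sum>w\<in>A. Poly_Mapping.lookup p w * nested_integral w)"
  unfolding sigma_raw_def
  by (rule sum.mono_neutral_left) (auto simp: in_keys_iff)

lemma sigma_raw_add: "sigma_raw (p + q) = sigma_raw p + sigma_raw q"
proof -
  let ?A = "Poly_Mapping.keys p \<union> Poly_Mapping.keys q"
  have "Poly_Mapping.keys (p + q) \<subseteq> ?A" by (rule Poly_Mapping.keys_add)
  thus ?thesis
    by (simp add: sigma_raw_superset[of ?A] lookup_add distrib_right sum.distrib)
qed

lemma sigma_raw_diff: "sigma_raw (p - q) = sigma_raw p - sigma_raw q"
  using sigma_raw_add[of "p - q" q] by simp

lemma sigma_raw_smul: "sigma_raw (smul c p) = c * sigma_raw p"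
proof -
  have "Poly_Mapping.keys (smul c p) \<subseteq> Poly_Mapping.keys p"
    by (auto simp: in_keys_iff)
  thus ?thesis
    by (simp add: sigma_raw_superset[of "Poly_Mapping.keys p"] sum_distrib_left mult.assoc)
qed

lemma sigma_raw_single: "sigma_raw (Poly_Mapping.single w c) = c * nested_integral w"
  using sigma_raw_superset[of "{w}" "Poly_Mapping.single w c"] by (simp split: if_splits)

lemma nested_integral_additive:
  "nested_integral (xs @ (a + b) # ys)
   = nested_integral (xs @ a # ys) + nested_integral (xs @ b # ys)"
  by (induction xs) (simp_all add: distrib_left distrib_right integ_add)

lemma nested_integral_homogeneous:
  "c \<in> constants \<Longrightarrow> nested_integral (xs @ (c * a) # ys) = c * nested_integral (xs @ a # ys)"
  by (induction xs) (simp_all add: constants_def mult.assoc mult.left_commute[of _ c] integ_scale)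

lemma sigma_raw_rel: "p \<in> multilinear_relations \<Longrightarrow> sigma_raw p = 0"
  by (induction rule: multilinear_relations.induct)
     (simp_all add: sigma_raw_add sigma_raw_smul sigma_raw_diff sigma_raw_single
       nested_integral_additive nested_integral_homogeneous, simp add: sigma_raw_def)

lift_definition sigma :: "'a::comm_integro_differential_ring tensor \<Rightarrow> 'a" is sigma_raw
  unfolding tensor_eq_def by (metis sigma_raw_rel sigma_raw_diff eq_iff_diff_eq_0)

definition e_form :: "'a tensor \<Rightarrow> 'a tensor \<Rightarrow> 'a::comm_integro_differential_ring"
  where "e_form f g = evaluation (sigma f * sigma g)"

(* The tensor of f_i, ..., f_j with 1-based indices; it is the empty tensor if i = j + 1. *)
definition slice :: "'a::comm_differential_ring list \<Rightarrow> nat \<Rightarrow> nat \<Rightarrow> 'a tensor"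
  where "slice f i j = pure_tensor (map (\<lambda>k. f ! (k - 1)) [i..<Suc j])"


lift_definition tensor_cons :: "'a::comm_differential_ring \<Rightarrow> 'a tensor \<Rightarrow> 'a tensor"
  is cons_raw
  unfolding tensor_eq_def by (metis cons_raw_const cons_raw_diff cons_raw_rel)

lemma tensor_cons_pure: "tensor_cons a (pure_tensor w) = pure_tensor (a # w)"
  by transfer
     (auto simp: cons_raw_def lin_ext_single smul_simps 
       intro!: tensor_eq_refl const_coeffs_closed constants_closed)

lemma tensor_cons_add: "tensor_cons a (s + t) = tensor_cons a s + tensor_cons a t"
  by transfer
     (auto simp: tensor_eq_def rel_zero cons_raw_add
       intro!: const_coeffs_closed cons_raw_const)

lemma sigma_pure: "sigma (pure_tensor w) = nested_integral w"
  by transfer (simp add: sigma_raw_single)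

lemma sigma_add: "sigma (s + t) = sigma s + sigma t"
  by transfer (simp add: sigma_raw_add)

lemma shuffle_raw_words:
  "shuffle_raw (Poly_Mapping.single u 1) (Poly_Mapping.single v 1) = shuffle_words u v"
  by (simp add: shuffle_raw_def lin_ext_single smul_simps)

lemma shuffle_pure_Nil:
  "pure_tensor [] \<squnion>\<squnion> pure_tensor v = pure_tensor v"
  "pure_tensor u \<squnion>\<squnion> pure_tensor [] = pure_tensor u"
  by (transfer, simp add: shuffle_raw_words tensor_eq_refl const_coeffs_closed constants_closed)+

lemma shuffle_pure_Cons:
  "pure_tensor (a # u) \<squnion>\<squnion> pure_tensor (b # v) =
     tensor_cons a (pure_tensor u \<squnion>\<squnion> pure_tensor (b # v))
     + tensor_cons b (pure_tensor (a # u) \<squnion>\<squnion> pure_tensor v)"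
  by transfer
     (auto simp: shuffle_raw_words
       intro!: tensor_eq_refl const_coeffs_closed cons_raw_const shuffle_words_const)

lemma shuffle_commute: "s \<squnion>\<squnion> t = t \<squnion>\<squnion> s"
  by transfer (metis shuffle_raw_commute shuffle_raw_const tensor_eq_def tensor_eq_refl)

lemma shuffle_add_left: "(s + t) \<squnion>\<squnion> r = s \<squnion>\<squnion> r + t \<squnion>\<squnion> r"
  by transfer
     (auto simp: tensor_eq_def shuffle_raw_add_left rel_zero
       intro!: const_coeffs_closed shuffle_raw_const)

end

theory Submission
  imports Defs
begin

text \<open>
  Nested integrals do not multiply by the shuffle product alone, because the evaluation
  need not be multiplicative. The failure is measured by constants: for words \<open>u\<close> and \<open>v\<close>,
    \<open>\<sigma>(u) \<sigma>(v) = \<sigma>(u \<squnion>\<squnion> v) + (\<Sum>i j. e(drop i u, drop j v) \<sigma>(take i u \<squnion>\<squnion> take j v))\<close>,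
  where \<open>i < length u\<close> and \<open>j < length v\<close>. This is \<open>nested_integral_mult\<close>. It follows by
  induction from \<open>x = \<integral> (\<partial> x) + E x\<close> for the product \<open>x\<close> of the two nested integrals: the
  Leibniz rule strips the first letter off either factor, and \<open>E x\<close> is the summand
  with \<open>i = j = 0\<close>.

  The identity is then associativity in disguise. The constant \<open>E (\<sigma>(f) \<sigma>(g) \<sigma>(h))\<close> can be
  expanded by multiplying out either \<open>\<sigma>(f) \<sigma>(g)\<close> or \<open>\<sigma>(g) \<sigma>(h)\<close> first, and linearity of \<open>E\<close>
  over constants turns the two expansions into the two halves of the claim.
\<close>

lemma integ_zero [simp]: "integ (0::'a::comm_integro_differential_ring) = 0"
  using integ_add[of "0::'a" 0] by simp

lemma integ_sum: "integ (\<Sum>x\<in>A. F x) = (\<Sum>x\<in>A. integ (F x))"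
  by (induction A rule: infinite_finite_induct) (simp_all add: integ_add)

lemma integ_scale_constants: "c \<in> constants \<Longrightarrow> integ (c * x) = c * integ x"
  by (simp add: constants_def integ_scale)

lemma evaluation_add: "evaluation (x + y) = evaluation x + evaluation y"
  by (simp add: evaluation_def der_add integ_add)

lemma evaluation_zero [simp]: "evaluation (0::'a::comm_integro_differential_ring) = 0"
  by (simp add: evaluation_def)

lemma evaluation_sum: "evaluation (\<Sum>x\<in>A. F x) = (\<Sum>x\<in>A. evaluation (F x))"
  by (induction A rule: infinite_finite_induct) (simp_all add: evaluation_add)

lemma evaluation_scale: "c \<in> constants \<Longrightarrow> evaluation (c * x) = c * evaluation x"
  by (simp add: evaluation_def constants_def der_mult integ_scale right_diff_distrib)

lemma sigma_raw_sum: "sigma_raw (\<Sum>x\<in>A. F x) = (\<Sum>x\<in>A. sigma_raw (F x))"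
  by (induction A rule: infinite_finite_induct)
     (simp_all add: sigma_raw_add sigma_raw_rel rel_zero)

lemma sigma_tensor_cons: "sigma (tensor_cons a t) = integ (a * sigma t)"
proof (transfer, goal_cases)
  case (1 a p)
  \<comment> \<open>A representative of a tensor has constant coefficients, so they move through the
    integral.\<close>
  then have const: "Poly_Mapping.lookup p w \<in> constants" for w
    by (simp add: tensor_eq_def const_coeffs_def)
  have "sigma_raw (cons_raw a p)
      = (\<Sum>w\<in>Poly_Mapping.keys p. Poly_Mapping.lookup p w * integ (a * nested_integral w))"
    by (simp add: cons_raw_def lin_ext_def sigma_raw_sum sigma_raw_smul sigma_raw_single)
  also have "\<dots> = integ (a * sigma_raw p)"
    by (simp add: sigma_raw_def sum_distrib_left integ_sum mult.left_commute[of a]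
        integ_scale_constants[OF const])
  finally show ?case .
qed

lemma sigma_shuffle_Cons:
  "sigma (pure_tensor (a # u) \<squnion>\<squnion> pure_tensor (b # v)) =
     integ (a * sigma (pure_tensor u \<squnion>\<squnion> pure_tensor (b # v)))
     + integ (b * sigma (pure_tensor (a # u) \<squnion>\<squnion> pure_tensor v))"
  by (simp add: shuffle_pure_Cons sigma_add sigma_tensor_cons)

text \<open>
  A sum over a grid whose entries obey a Pascal-type recursion splits into the contributions
  coming from the left and from above. This is the bookkeeping for the two ways in which
  a shuffle of two prefixes can begin.
\<close>

lemma sum_grid_Suc:
  fixes T A B :: "nat \<Rightarrow> nat \<Rightarrow> 'a::comm_monoid_add"
  assumes "\<And>i. T (Suc i) 0 = A i 0"
    and "\<And>j. T 0 (Suc j) = B 0 j"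
    and "\<And>i j. T (Suc i) (Suc j) = A i (Suc j) + B (Suc i) j"
  shows "(\<Sum>i<Suc n. \<Sum>j<Suc m. T i j)
       = T 0 0 + (\<Sum>i<n. \<Sum>j<Suc m. A i j) + (\<Sum>i<Suc n. \<Sum>j<m. B i j)"
  unfolding sum.lessThan_Suc_shift
  by (simp add: assms sum.distrib add_ac)

text \<open>
  The case distinction of the induction mirrors the recursion of the shuffle product.
  If one word is empty, the correction sum is empty and the shuffle is the other word.
\<close>

theorem nested_integral_mult:
  fixes u v :: "'a::comm_integro_differential_ring list"
  shows "nested_integral u * nested_integral v = sigma (pure_tensor u \<squnion>\<squnion> pure_tensor v)
    + (\<Sum>i<length u. \<Sum>j<length v.
         e_form (pure_tensor (drop i u)) (pure_tensor (drop j v))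
         * sigma (pure_tensor (take i u) \<squnion>\<squnion> pure_tensor (take j v)))"
proof (induction u v rule: shuffle_words.induct)
  case (1 v)
  show ?case by (simp add: shuffle_pure_Nil sigma_pure)
next
  case (2 a u)
  show ?case by (simp add: shuffle_pure_Nil sigma_pure)
next
  case (3 a u b v)
  define W :: "'a list \<Rightarrow> 'a list \<Rightarrow> 'a"
    where "W x y = sigma (pure_tensor x \<squnion>\<squnion> pure_tensor y)" for x y
  define c where "c i j = e_form (pure_tensor (drop i (a # u))) (pure_tensor (drop j (b # v)))"
    for i j
  have c_const: "c i j \<in> constants" for i j
    by (simp add: c_def e_form_def evaluation_constant)
  have W_Cons: "W (a # x) (b # y) = integ (a * W x (b # y)) + integ (b * W (a # x) y)" for x y
    by (simp add: W_def sigma_shuffle_Cons)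
  have W_Nil: "W (d # x) [] = integ (d * W x [])" "W [] (d # x) = integ (d * W [] x)"
    "W [] [] = 1" for d x
    by (simp_all add: W_def shuffle_pure_Nil sigma_pure)
  let ?x = "nested_integral (a # u) * nested_integral (b # v)"
  define A where "A i j = c (Suc i) j * integ (a * W (take i u) (take j (b # v)))" for i j
  define B where "B i j = c i (Suc j) * integ (b * W (take i (a # u)) (take j v))" for i j
  have IH1: "nested_integral u * nested_integral (b # v) = W u (b # v)
      + (\<Sum>i<length u. \<Sum>j<Suc (length v). c (Suc i) j * W (take i u) (take j (b # v)))"
    using 3(1) by (simp only: W_def c_def list.size drop_Suc_Cons add_0_right add_Suc_right)
  have IH2: "nested_integral (a # u) * nested_integral v = W (a # u) v
      + (\<Sum>i<Suc (length u). \<Sum>j<length v. c i (Suc j) * W (take i (a # u)) (take j v))"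
    using 3(2) by (simp only: W_def c_def list.size drop_Suc_Cons add_0_right add_Suc_right)
  have int1: "integ (a * (nested_integral u * nested_integral (b # v)))
      = integ (a * W u (b # v)) + (\<Sum>i<length u. \<Sum>j<Suc (length v). A i j)"
    unfolding IH1
    by (simp only: A_def distrib_left sum_distrib_left integ_add integ_sum mult.left_commute[of a]
        integ_scale_constants[OF c_const])
  have int2: "integ (b * (nested_integral (a # u) * nested_integral v))
      = integ (b * W (a # u) v) + (\<Sum>i<Suc (length u). \<Sum>j<length v. B i j)"
    unfolding IH2
    by (simp only: B_def distrib_left sum_distrib_left integ_add integ_sum mult.left_commute[of b]
        integ_scale_constants[OF c_const])
  have "?x = integ (der ?x) + evaluation ?x"
    by (simp add: evaluation_def)
  also have "evaluation ?x = c 0 0"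
    by (simp add: c_def e_form_def sigma_pure)
  also have "der ?x = a * (nested_integral u * nested_integral (b # v))
      + b * (nested_integral (a # u) * nested_integral v)"
    by (simp add: der_mult der_integ mult_ac)
  also have "integ \<dots> + c 0 0 = W (a # u) (b # v)
      + (c 0 0 + (\<Sum>i<length u. \<Sum>j<Suc (length v). A i j)
        + (\<Sum>i<Suc (length u). \<Sum>j<length v. B i j))"
    by (simp only: integ_add int1 int2 W_Cons add_ac)
  \<comment> \<open>On the border of the grid one prefix is empty, so the shuffle can begin in only one way;
    in the corner both are empty and \<open>\<sigma>\<close> is \<open>1\<close>.\<close>
  also have "c 0 0 + (\<Sum>i<length u. \<Sum>j<Suc (length v). A i j)
        + (\<Sum>i<Suc (length u). \<Sum>j<length v. B i j)
      = (\<Sum>i<Suc (length u). \<Sum>j<Suc (length v).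
          c i j * W (take i (a # u)) (take j (b # v)))"
    by (subst sum_grid_Suc[where A = A and B = B])
       (simp_all add: A_def B_def W_Nil W_Cons distrib_left)
  finally show ?case
    by (simp only: W_def c_def list.size add_0_right add_Suc_right)
qed

lemma e_form_commute: "e_form s t = e_form t s"
  by (simp add: e_form_def mult.commute)

lemma evaluation_nested_integral_mult3:
  fixes u v :: "'a::comm_integro_differential_ring list"
  shows "evaluation (nested_integral u * nested_integral v * nested_integral w) =
    e_form (pure_tensor u \<squnion>\<squnion> pure_tensor v) (pure_tensor w)
    + (\<Sum>i<length u. \<Sum>j<length v.
         e_form (pure_tensor (drop i u)) (pure_tensor (drop j v))
         * e_form (pure_tensor (take i u) \<squnion>\<squnion> pure_tensor (take j v)) (pure_tensor w))"
proof -
  have "e_form s t \<in> constants" for s t :: "'a tensor"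
    by (simp add: e_form_def evaluation_constant)
  note scale = evaluation_scale[OF this]
  show ?thesis
    by (simp add: nested_integral_mult distrib_right sum_distrib_right mult.assoc evaluation_add
        evaluation_sum scale) (simp add: e_form_def sigma_pure)
qed

lemma slice_suffix: "slice f (i + 1) (length f) = pure_tensor (drop i f)"
  unfolding slice_def
  by (rule arg_cong[where f = pure_tensor]) (auto intro!: nth_equalityI simp del: upt_Suc)

lemma slice_prefix: "i \<le> length f \<Longrightarrow> slice f 1 i = pure_tensor (take i f)"
  unfolding slice_def
  by (rule arg_cong[where f = pure_tensor]) (auto intro!: nth_equalityI simp del: upt_Suc)

theorem corollary4:
  fixes f g h :: "'a::comm_integro_differential_ring list"
    and n m l :: nat
  assumes "length f = n" and "length g = m" and "length h = l"
  shows "e_form (pure_tensor f \<squnion>\<squnion> pure_tensor g) (pure_tensor h)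
       - e_form (pure_tensor f) (pure_tensor g \<squnion>\<squnion> pure_tensor h)
       + (\<Sum>j<m.
            (\<Sum>i<n. e_form (slice f (i + 1) n) (slice g (j + 1) m)
                   * e_form (slice f 1 i \<squnion>\<squnion> slice g 1 j) (pure_tensor h))
          - (\<Sum>k<l. e_form (pure_tensor f) (slice g 1 j \<squnion>\<squnion> slice h 1 k)
                   * e_form (slice g (j + 1) m) (slice h (k + 1) l)))
       = 0"
proof -
  let ?E = "evaluation (nested_integral f * nested_integral g * nested_integral h)"
  have left: "?E = e_form (pure_tensor f \<squnion>\<squnion> pure_tensor g) (pure_tensor h)
      + (\<Sum>j<m. \<Sum>i<n. e_form (slice f (i + 1) n) (slice g (j + 1) m)
           * e_form (slice f 1 i \<squnion>\<squnion> slice g 1 j) (pure_tensor h))"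
    unfolding evaluation_nested_integral_mult3 assms[symmetric] slice_suffix
    by (subst sum.swap) (simp add: slice_prefix[unfolded One_nat_def])
  have "?E = evaluation (nested_integral g * nested_integral h * nested_integral f)"
    by (simp add: mult_ac)
  also have "\<dots> = e_form (pure_tensor f) (pure_tensor g \<squnion>\<squnion> pure_tensor h)
      + (\<Sum>j<m. \<Sum>k<l. e_form (pure_tensor f) (slice g 1 j \<squnion>\<squnion> slice h 1 k)
           * e_form (slice g (j + 1) m) (slice h (k + 1) l))"
    unfolding evaluation_nested_integral_mult3 assms[symmetric] slice_suffix
    by (simp add: slice_prefix[unfolded One_nat_def] e_form_commute[of "pure_tensor f"] mult.commute)
  finally show ?thesis
    using left by (simp add: sum_subtractf algebra_simps)
qed

end
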